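(* Let $X$ be a compact metric space of zero topological dimension and let $T\colon X\to X$ be a homeomorphism. Let $N>0$ be an integer and suppose that the set of periodic points of $T$ of period less than $N$ is finite. Let $\delta>0$. Then there exists a castle partition of $X$ into finitely many $N$-capturing towers whose floors are clopen sets of diameter less than $\delta$.
   Context: A topological space has zero topological dimension if every open cover can be refined to an open partition (for compact metric spaces, equivalently, the clopen sets form a basis of the topology). Let $T\colon X\to X$ be a bijection. If $\ell\ge 1$ is an integer and $B\subseteq X$ satisfies $B\cap T^{-i}B=\emptyset$ for all integers $1\le i\le \ell-1$, then the set $K=\bigsqcup_{i=0}^{\ell-1}T^iB$ (a disjoint union) is called a tower with base $B$ and height $\ell$, and the disjoint sets $B,TB,\dots,T^{\ell-1}B$ are called its floors. A castle is a disjoint union of towers; it is a castle partition if it covers the whole space $X$. For a positive integer $N$, a set $E\subseteq X$ is called $N$-capturing (with respect to $T$) if $E\setminus TE\subseteq\bigcap_{n=0}^{N-1}T^{-n}E$. *)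

theory Defs
  imports "HOL-Analysis.Analysis"
begin

definition zero_dimensional :: "'a topology \<Rightarrow> bool" where
  "zero_dimensional \<tau> \<longleftrightarrow>
     (\<forall>\<U>. (\<forall>U\<in>\<U>. openin \<tau> U) \<and> \<Union>\<U> = topspace \<tau> \<longrightarrow>
        (\<exists>\<P>. partition_on (topspace \<tau>) \<P> \<and>
             (\<forall>P\<in>\<P>. openin \<tau> P \<and> (\<exists>U\<in>\<U>. P \<subseteq> U))))"

text \<open>In the following, the phase space is a set \<open>X\<close> and \<open>T\<close> restricts to a bijection of \<open>X\<close>;
  values of \<open>T\<close> outside \<open>X\<close> play no role. Accordingly \<open>T\<^sup>-\<^sup>i E\<close> is the preimage within \<open>X\<close>.\<close>

definition preim :: "'a set \<Rightarrow> ('a \<Rightarrow> 'a) \<Rightarrow> nat \<Rightarrow> 'a set \<Rightarrow> 'a set" where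
  "preim X T i E = {x \<in> X. (T ^^ i) x \<in> E}"

text \<open>Periods need not be minimal; a point has some period below \<open>N\<close> iff its least period
  is below \<open>N\<close>.\<close>

definition has_period :: "('a \<Rightarrow> 'a) \<Rightarrow> 'a \<Rightarrow> nat \<Rightarrow> bool" where
  "has_period T x p \<longleftrightarrow> p \<ge> 1 \<and> (T ^^ p) x = x"

text \<open>A tower is recorded by its base and height, which are not determined by the
  underlying set.\<close>

definition is_tower :: "'a set \<Rightarrow> ('a \<Rightarrow> 'a) \<Rightarrow> 'a set \<Rightarrow> nat \<Rightarrow> bool" where
  "is_tower X T B l \<longleftrightarrow> l \<ge> 1 \<and> B \<subseteq> X \<and> (\<forall>i\<in>{1..l - 1}. B \<inter> preim X T i B = {})"

definition floors :: "('a \<Rightarrow> 'a) \<Rightarrow> 'a set \<Rightarrow> nat \<Rightarrow> 'a set set" where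
  "floors T B l = (\<lambda>i. (T ^^ i) ` B) ` {..<l}"

definition tower :: "('a \<Rightarrow> 'a) \<Rightarrow> 'a set \<Rightarrow> nat \<Rightarrow> 'a set" where
  "tower T B l = (\<Union>i<l. (T ^^ i) ` B)"

definition castle :: "'a set \<Rightarrow> ('a \<Rightarrow> 'a) \<Rightarrow> ('a set \<times> nat) set \<Rightarrow> bool" where
  "castle X T \<C> \<longleftrightarrow>
     (\<forall>(B, l)\<in>\<C>. is_tower X T B l) \<and> disjoint_family_on (\<lambda>(B, l). tower T B l) \<C>"

definition castle_partition :: "'a set \<Rightarrow> ('a \<Rightarrow> 'a) \<Rightarrow> ('a set \<times> nat) set \<Rightarrow> bool" where
  "castle_partition X T \<C> \<longleftrightarrow> castle X T \<C> \<and> (\<Union>(B, l)\<in>\<C>. tower T B l) = X"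

definition capturing :: "'a set \<Rightarrow> ('a \<Rightarrow> 'a) \<Rightarrow> nat \<Rightarrow> 'a set \<Rightarrow> bool" where
  "capturing X T N E \<longleftrightarrow> E - T ` E \<subseteq> (\<Inter>n\<in>{0..<N}. preim X T n E)"

end

theory Submission
  imports Defs
begin

text \<open>
  A tower of height at least \<open>N\<close> is capturing for free: an orbit can only enter it through its
  base, and then climbs through all floors. A point of least period \<open>p < N\<close> however lies in
  no tower higher than \<open>p\<close>. The proof therefore treats a neighbourhood of the finitely many
  periodic points of small period separately from the rest of the space.

  Near a point \<open>x\<close> of least period \<open>p < N\<close> the tower has height \<open>p\<close>, and its base \<open>B\<close> has to
  be such that a point entering \<open>B\<close> under \<open>T\<^sup>p\<close> stays in \<open>B\<close> for \<open>N\<close> steps. The complement of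
  all these towers should be capturing too, for otherwise an orbit could visit it too briefly
  to fit a tower of height \<open>N\<close> in between. Both properties are properties of the set of times
  \<open>k\<close> at which \<open>T\<^sup>p\<^sup>k y\<close> is in \<open>B\<close>: its runs and its gaps must have length at least \<open>N\<close>. Starting
  from any set of times, lengthening each point to a run of length \<open>2N\<close> and then
  shortening each run by \<open>N - 1\<close> at one end achieves this (\<open>capturing_smoothed\<close>,
  \<open>capturing_compl_smoothed\<close>). If one starts with a clopen neighbourhood of \<open>x\<close> that is so
  small that it shadows the orbit of \<open>x\<close> for a long time, the result is again a small clopen
  neighbourhood, and orbits pass from one tower to another only after \<open>N\<close> steps
  (\<open>bases_at_periodic_points\<close>, \<open>small_castle_at_short_periods\<close>).

  The complement \<open>Y\<close> of these towers is clopen, capturing and free of points of period less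
  than \<open>N\<close>. A greedy choice gives a clopen set \<open>F\<close> of markers in \<open>Y\<close>, containing all entry points
  of \<open>Y\<close>, such that markers on an orbit are at least \<open>N\<close> steps apart and at least \<open>N\<close> steps
  before the next exit from \<open>Y\<close>, and such that no further marker could be added
  (\<open>clopen_marker\<close>). Maximality forces every point of \<open>Y\<close> to
  be a marker or to have one among its last \<open>2N\<close> predecessors, with the orbit staying in \<open>Y\<close> in
  between (\<open>marker_in_recent_past\<close>). Cutting
  the orbits at the markers, that is, sorting \<open>F\<close> by the time until the next marker or
  exit, yields towers of heights between \<open>N\<close> and \<open>2N + 1\<close> that fill \<open>Y\<close>. Their height being
  bounded, the bases can be partitioned finely enough for all floors to be small
  (\<open>high_castle_without_short_periods\<close>).
\<close>

section \<open>Iterates of a bijection\<close>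

lemma mem_preim: "x \<in> preim X T n E \<longleftrightarrow> x \<in> X \<and> (T ^^ n) x \<in> E"
  by (simp add: preim_def)

lemma bij_betw_funpow_on:
  assumes "bij_betw f X X"
  shows "bij_betw (f ^^ n) X X"
proof (induction n)
  case 0
  then show ?case by (simp add: bij_betw_def)
next
  case (Suc n)
  then show ?case using bij_betw_trans[OF Suc assms] by (simp add: o_def)
qed

lemma funpow_in:
  assumes "bij_betw f X X" "x \<in> X"
  shows "(f ^^ n) x \<in> X"
  using bij_betw_funpow_on[OF assms(1), of n] assms(2) by (auto simp: bij_betw_def)

lemma funpow_cancel:
  assumes f: "bij_betw f X X" and "x \<in> X" "y \<in> X" and eq: "(f ^^ m) x = (f ^^ n) y" and "m \<le> n"
  shows "x = (f ^^ (n - m)) y"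
proof -
  have "(f ^^ m) x = (f ^^ m) ((f ^^ (n - m)) y)"
    using eq \<open>m \<le> n\<close> by (simp flip: funpow_add[THEN fun_cong, unfolded o_apply])
  then show ?thesis
    using bij_betw_funpow_on[OF f, of m] funpow_in[OF f] assms(2,3)
    by (auto simp: bij_betw_def inj_on_def)
qed

lemma funpow_surj:
  assumes "bij_betw f X X" "y \<in> X"
  obtains z where "z \<in> X" "(f ^^ n) z = y"
  using bij_betw_funpow_on[OF assms(1), of n] assms(2) that
  by (metis bij_betw_imp_surj_on imageE)

lemma funpow_plus: "(f ^^ m) ((f ^^ n) x) = (f ^^ (m + n)) x"
  by (simp add: funpow_add)

section \<open>Capturing sets and capturing towers\<close>

lemma capturingI:
  assumes "\<And>y n. y \<in> E \<Longrightarrow> y \<notin> T ` E \<Longrightarrow> n < N \<Longrightarrow> y \<in> X \<and> (T ^^ n) y \<in> E"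
  shows "capturing X T N E"
  using assms unfolding capturing_def by (auto simp: mem_preim)

lemma capturingD:
  assumes "capturing X T N E" "y \<in> E" "y \<notin> T ` E" "n < N"
  shows "(T ^^ n) y \<in> E"
  using assms unfolding capturing_def by (auto simp: mem_preim)

lemma tower_memI: "b \<in> B \<Longrightarrow> i < l \<Longrightarrow> y = (T ^^ i) b \<Longrightarrow> y \<in> tower T B l"
  unfolding tower_def by blast

lemma tower_memE:
  assumes "y \<in> tower T B l"
  obtains b i where "b \<in> B" "i < l" "y = (T ^^ i) b"
  using assms unfolding tower_def by blast

text \<open>A point on a higher floor comes from the floor below, and a point of \<open>T\<^sup>l B\<close> comes from the
  top floor.\<close>

lemma tower_entry:
  assumes "y \<in> tower T B l" "y \<notin> T ` tower T B l"
  shows "y \<in> B" "y \<notin> (T ^^ l) ` B"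
proof -
  obtain b i where b: "b \<in> B" "i < l" "y = (T ^^ i) b" using assms(1) by (rule tower_memE)
  have "i = 0"
  proof (rule ccontr)
    assume "i \<noteq> 0"
    then have "y = T ((T ^^ (i - 1)) b)" using b(3) by (cases i) auto
    moreover have "(T ^^ (i - 1)) b \<in> tower T B l"
      using b by (intro tower_memI[of b _ "i - 1"]) auto
    ultimately show False using assms(2) by blast
  qed
  then show "y \<in> B" using b by simp
  show "y \<notin> (T ^^ l) ` B"
  proof
    assume "y \<in> (T ^^ l) ` B"
    then obtain c where c: "c \<in> B" "y = (T ^^ l) c" by blast
    then have "y = T ((T ^^ (l - 1)) c)" using b(2) by (cases l) auto
    moreover have "(T ^^ (l - 1)) c \<in> tower T B l"
      using b(2) c by (intro tower_memI[of c _ "l - 1"]) auto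
    ultimately show False using assms(2) by blast
  qed
qed

lemma capturing_tower_high:
  assumes "B \<subseteq> X" "N \<le> l"
  shows "capturing X T N (tower T B l)"
proof (rule capturingI)
  fix y n assume y: "y \<in> tower T B l" "y \<notin> T ` tower T B l" and n: "n < N"
  have "y \<in> B" by (rule tower_entry[OF y])
  then show "y \<in> X \<and> (T ^^ n) y \<in> tower T B l"
    using assms n by (auto intro!: tower_memI[of y B n])
qed

text \<open>An orbit enters the tower through the base. If the base is capturing for \<open>T\<^sup>l\<close>, the orbit
  climbs the \<open>l\<close> floors \<open>N\<close> times in a row, which takes at least \<open>N\<close> steps.\<close>

lemma capturing_tower_low:
  assumes "B \<subseteq> X" "capturing X (T ^^ l) N B" "0 < l"
  shows "capturing X T N (tower T B l)"
proof (rule capturingI)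
  fix y n assume y: "y \<in> tower T B l" "y \<notin> T ` tower T B l" and n: "n < N"
  have *: "y \<in> B" "y \<notin> (T ^^ l) ` B" by (rule tower_entry[OF y])+
  have "n div l < N" using n by (meson div_le_dividend le_less_trans)
  then have "((T ^^ l) ^^ (n div l)) y \<in> B" by (rule capturingD[OF assms(2) *])
  moreover have "(T ^^ n) y = (T ^^ (n mod l)) (((T ^^ l) ^^ (n div l)) y)"
    by (simp add: funpow_mult funpow_plus)
  ultimately show "y \<in> X \<and> (T ^^ n) y \<in> tower T B l"
    using * assms by (auto intro!: tower_memI[of _ B "n mod l"])
qed

text \<open>On the set of times at which an orbit of \<open>f\<close> is in \<open>W\<close>, this is a dilation forwards by
  \<open>2N - 1\<close> followed by an erosion that keeps a time only if the next \<open>N - 1\<close> times are present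
  too. The dilation makes runs long, the erosion makes gaps long, and the runs are still long
  enough afterwards.\<close>

definition smoothed :: "'a set \<Rightarrow> ('a \<Rightarrow> 'a) \<Rightarrow> nat \<Rightarrow> 'a set \<Rightarrow> 'a set" where
  "smoothed X f N W = (\<Inter>j\<in>{..<N}. preim X f j (\<Union>i\<in>{..<2 * N}. (f ^^ i) ` W))"

lemma smoothed_mem:
  assumes "0 < N"
  shows "y \<in> smoothed X f N W \<longleftrightarrow> y \<in> X \<and> (\<forall>j<N. \<exists>i<2 * N. (f ^^ j) y \<in> (f ^^ i) ` W)"
  using assms unfolding smoothed_def by (auto simp: mem_preim Bex_def)

text \<open>A run of the smoothed set begins where a run of the dilated set begins, hence at a point
  of \<open>W\<close>. The dilated set then contains \<open>2N\<close> consecutive times from there on, and the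
  first \<open>N\<close> of them survive the erosion.\<close>

lemma capturing_smoothed:
  assumes f: "bij_betw f X X" and "W \<subseteq> X" and N: "0 < N"
  shows "capturing X f N (smoothed X f N W)"
proof (rule capturingI)
  fix y n
  assume y: "y \<in> smoothed X f N W" "y \<notin> f ` smoothed X f N W" and n: "n < N"
  have yX: "y \<in> X" using y N by (simp add: smoothed_mem)
  have yD: "\<exists>i<2 * N. (f ^^ j) y \<in> (f ^^ i) ` W" if "j < N" for j
    using y(1) that N by (simp add: smoothed_mem)
  obtain z where z: "z \<in> X" "f z = y" using funpow_surj[OF f yX, of 1] by auto
  then have "z \<notin> smoothed X f N W" using y(2) by blast
  then obtain j where j: "j < N" "\<forall>i<2 * N. (f ^^ j) z \<notin> (f ^^ i) ` W"
    using z N by (auto simp: smoothed_mem)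
  (* the time missing from the window of z cannot belong to the window of its successor y *)
  have j0: "j = 0"
  proof (rule ccontr)
    assume "j \<noteq> 0"
    then have "(f ^^ (j - 1)) y = (f ^^ j) z" using z(2) by (cases j) (auto simp: funpow_swap1)
    moreover have "j - 1 < N" using j by simp
    ultimately show False using yD[of "j - 1"] j by metis
  qed
  obtain i w where i: "i < 2 * N" "w \<in> W" "y = (f ^^ i) w" using yD[of 0] N by auto
  have "i = 0"
  proof (rule ccontr)
    assume "i \<noteq> 0"
    then have "(f ^^ 1) z = (f ^^ i) w" "1 \<le> i" using z(2) i by auto
    then have "z = (f ^^ (i - 1)) w"
      using funpow_cancel[OF f z(1), of w 1 i] i(2) assms(2) by auto
    then show False using j j0 i by (metis funpow_0 image_eqI less_imp_diff_less)
  qed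
  then have "y \<in> W" using i by simp
  have "\<exists>i<2 * N. (f ^^ k) ((f ^^ n) y) \<in> (f ^^ i) ` W" if "k < N" for k
    using that n \<open>y \<in> W\<close> by (intro exI[of _ "k + n"]) (auto simp: funpow_plus)
  then show "y \<in> X \<and> (f ^^ n) y \<in> smoothed X f N W"
    using yX funpow_in[OF f yX] N by (simp add: smoothed_mem)
qed

text \<open>When an orbit leaves the smoothed set, the window of length \<open>N\<close> has just reached a time
  that is missing from the dilated set; that time stays inside the window for \<open>N\<close> steps.\<close>

lemma capturing_compl_smoothed:
  assumes f: "bij_betw f X X" and N: "0 < N"
  shows "capturing X f N (X - smoothed X f N W)"
proof (rule capturingI)
  fix y n
  assume y: "y \<in> X - smoothed X f N W" "y \<notin> f ` (X - smoothed X f N W)" and n: "n < N"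
  have yX: "y \<in> X" using y by simp
  obtain z where z: "z \<in> X" "f z = y" using funpow_surj[OF f yX, of 1] by auto
  then have zB: "z \<in> smoothed X f N W" using y(2) by blast
  obtain j where j: "j < N" "\<forall>i<2 * N. (f ^^ j) y \<notin> (f ^^ i) ` W"
    using y N by (auto simp: smoothed_mem)
  have "j = N - 1"
  proof (rule ccontr)
    assume "j \<noteq> N - 1"
    then have "Suc j < N" using j by simp
    moreover have "(f ^^ j) y = (f ^^ Suc j) z" using z by (auto simp: funpow_swap1)
    moreover have "\<exists>i<2 * N. (f ^^ Suc j) z \<in> (f ^^ i) ` W"
      using zB \<open>Suc j < N\<close> N by (simp add: smoothed_mem del: funpow.simps)
    ultimately show False using j by metis
  qed
  have "(f ^^ n) y \<notin> smoothed X f N W"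
  proof
    assume "(f ^^ n) y \<in> smoothed X f N W"
    moreover have "N - 1 - n < N" using N by simp
    ultimately obtain i where "i < 2 * N" "(f ^^ (N - 1 - n)) ((f ^^ n) y) \<in> (f ^^ i) ` W"
      using N smoothed_mem by metis
    then show False using j n \<open>j = N - 1\<close> by (simp add: funpow_plus)
  qed
  then show "y \<in> X \<and> (f ^^ n) y \<in> X - smoothed X f N W"
    using yX funpow_in[OF f yX] by simp
qed

section \<open>Uniform smallness\<close>

lemma diameter_less:
  fixes F :: "'a::metric_space set"
  assumes "0 < \<delta>" "\<And>a b. a \<in> F \<Longrightarrow> b \<in> F \<Longrightarrow> dist a b < \<delta> / 2"
  shows "diameter F < \<delta>"
proof (cases "F = {}")
  case False
  have "(SUP (a, b)\<in>F \<times> F. dist a b) \<le> \<delta> / 2"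
  proof (rule cSUP_least)
    show "F \<times> F \<noteq> {}" using False by simp
    show "(case c of (a, b) \<Rightarrow> dist a b) \<le> \<delta> / 2" if "c \<in> F \<times> F" for c
      using that assms(2) by (auto intro: less_imp_le)
  qed
  then have "diameter F \<le> \<delta> / 2" using False by (simp add: diameter_def)
  then show ?thesis using assms(1) by linarith
qed (use assms in simp)

lemma finite_uniform_positive:
  fixes Q :: "'i \<Rightarrow> real \<Rightarrow> bool"
  assumes "finite I" "\<And>i. i \<in> I \<Longrightarrow> \<exists>e>0. Q i e"
    and mono: "\<And>i e e'. Q i e \<Longrightarrow> e' \<le> e \<Longrightarrow> Q i e'"
  shows "\<exists>e>0. \<forall>i\<in>I. Q i e"
  using assms(1,2)
proof (induction I rule: finite_induct)
  case empty
  then show ?case by (auto intro: exI[of _ 1])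
next
  case (insert i I)
  obtain d e where "0 < d" "Q i d" "0 < e" "\<forall>i\<in>I. Q i e" using insert by blast
  then have "Q i (min d e)" "\<forall>i\<in>I. Q i (min d e)" using mono by (meson min.cobounded1 min.cobounded2)+
  with \<open>0 < d\<close> \<open>0 < e\<close> show ?case by (intro exI[of _ "min d e"]) simp
qed

section \<open>Periodic points of small period\<close>

definition short_periodic :: "'a set \<Rightarrow> ('a \<Rightarrow> 'a) \<Rightarrow> nat \<Rightarrow> 'a set" where
  "short_periodic X T N = {x \<in> X. \<exists>p<N. has_period T x p}"

lemma short_periodic_iterate:
  assumes "bij_betw T X X" and q: "q \<in> short_periodic X T N"
  shows "(T ^^ i) q \<in> short_periodic X T N"
proof -
  obtain p where p: "p < N" "has_period T q p" using q by (auto simp: short_periodic_def)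
  have "(T ^^ p) ((T ^^ i) q) = (T ^^ i) ((T ^^ p) q)" by (simp add: funpow_plus add.commute)
  then have "has_period T ((T ^^ i) q) p" using p(2) by (simp add: has_period_def)
  then show ?thesis
    using p(1) funpow_in[OF assms(1)] q by (auto simp: short_periodic_def)
qed

text \<open>One point \<open>x\<close> is chosen on each orbit, and \<open>per x\<close> is its least period; the third property
  says that positions on these orbits are determined by the representative and by the time
  modulo the period.\<close>

lemma orbit_representatives:
  fixes X :: "'a set" and T :: "'a \<Rightarrow> 'a" and N :: nat
  defines "P \<equiv> short_periodic X T N"
  assumes bij: "bij_betw T X X"
  obtains R per where "R \<subseteq> P"
    "\<And>x. x \<in> R \<Longrightarrow> 0 < per x \<and> per x < N \<and> (T ^^ per x) x = x"
    "\<And>x x' i j. x \<in> R \<Longrightarrow> x' \<in> R \<Longrightarrow> (T ^^ i) x = (T ^^ j) x' \<Longrightarrow>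
       x = x' \<and> i mod per x = j mod per x"
    "\<And>q. q \<in> P \<Longrightarrow> \<exists>x\<in>R. \<exists>i<per x. q = (T ^^ i) x"
proof -
  define per where "per q = (LEAST p. has_period T q p)" for q
  have PX: "q \<in> X" if "q \<in> P" for q using that by (simp add: P_def short_periodic_def)
  have P_iter: "(T ^^ i) q \<in> P" if q: "q \<in> P" for q i
    using short_periodic_iterate[OF bij] q by (simp add: P_def)
  have per: "1 \<le> per q" "per q < N" "(T ^^ per q) q = q" if q: "q \<in> P" for q
  proof -
    obtain p where p: "p < N" "has_period T q p" using q by (auto simp: P_def short_periodic_def)
    then have "has_period T q (per q)" "per q \<le> p"
      unfolding per_def by (auto intro: LeastI Least_le)
    then show "1 \<le> per q" "per q < N" "(T ^^ per q) q = q"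
      using p by (auto simp: has_period_def)
  qed
  have modper: "(T ^^ (n mod per q)) q = (T ^^ n) q" if "q \<in> P" for q n
    by (rule funpow_mod_eq[OF per(3)[OF that]])
  have inj_le: "i = j" if "q \<in> P" "i \<le> j" "j < per q" "(T ^^ i) q = (T ^^ j) q" for q i j
  proof -
    have "(T ^^ (j - i)) q = q"
      using funpow_cancel[OF bij PX[OF that(1)] PX[OF that(1)] that(4,2)] by simp
    moreover have "\<not> has_period T q (j - i)"
      unfolding per_def by (rule not_less_Least) (use that in \<open>simp add: per_def\<close>)
    ultimately show ?thesis using that(2) by (simp add: has_period_def)
  qed
  have same_mod: "m mod per q = n mod per q" if "q \<in> P" "(T ^^ m) q = (T ^^ n) q" for q m n
  proof -
    have "m mod per q < per q" "n mod per q < per q" using per(1)[OF that(1)] by auto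
    then show ?thesis
      using inj_le[OF that(1), of "m mod per q" "n mod per q"]
        inj_le[OF that(1), of "n mod per q" "m mod per q"] that modper[OF that(1)]
      by (metis linear)
  qed
  define orbit where "orbit q = range (\<lambda>i. (T ^^ i) q)" for q
  define rep where "rep q = (SOME z. z \<in> orbit q)" for q
  have orbit_eq: "orbit ((T ^^ i) q) = orbit q" if q: "q \<in> P" for q i
  proof -
    have *: "orbit ((T ^^ i) z) \<subseteq> orbit z" for z i
      by (auto simp: orbit_def funpow_plus)
    have "(T ^^ (per q * i - i)) ((T ^^ i) q) = (T ^^ (per q * i)) q"
      using per(1)[OF q] by (simp add: funpow_plus)
    also have "\<dots> = q" using modper[OF q, of "per q * i"] by simp
    finally show ?thesis using * by (metis subset_antisym)
  qed
  have rep_in: "rep q \<in> orbit q" for q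
    unfolding rep_def by (rule someI[of _ q]) (auto simp: orbit_def intro: exI[of _ 0] image_eqI[of _ _ 0])
  define R where "R = rep ` P"
  have RP: "x \<in> P" if x: "x \<in> R" for x
  proof -
    obtain q where q: "q \<in> P" "x = rep q" using x by (auto simp: R_def)
    obtain i where "x = (T ^^ i) q" using rep_in[of q] q(2) by (auto simp: orbit_def)
    then show ?thesis using P_iter[OF q(1)] by simp
  qed
  have rep_R: "rep x = x" if x: "x \<in> R" for x
  proof -
    obtain q where q: "q \<in> P" "x = rep q" using x by (auto simp: R_def)
    then have "orbit x = orbit q" using rep_in[of q] orbit_eq by (auto simp: orbit_def[of q])
    then show ?thesis using q by (simp add: rep_def)
  qed
  have R_eq: "x = x'" if "x \<in> R" "x' \<in> R" "(T ^^ i) x = (T ^^ j) x'" for x x' i j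
  proof -
    have "orbit x = orbit x'"
      using orbit_eq[OF RP[OF that(1)], of i] orbit_eq[OF RP[OF that(2)], of j] that(3) by simp
    then have "rep x = rep x'" by (simp add: rep_def)
    then show ?thesis using rep_R that by simp
  qed
  have P_rep: "\<exists>x\<in>R. \<exists>i. q = (T ^^ i) x" if q: "q \<in> P" for q
  proof -
    have "orbit (rep q) = orbit q" using rep_in[of q] orbit_eq[OF q] by (auto simp: orbit_def[of q])
    moreover have "q \<in> orbit q" by (auto simp: orbit_def intro: image_eqI[of _ _ 0])
    ultimately have "q \<in> orbit (rep q)" by simp
    then show ?thesis using q by (auto simp: orbit_def R_def)
  qed

  show ?thesis
  proof (rule that[of R per])
    show "R \<subseteq> P" using RP by blast
    show "0 < per x \<and> per x < N \<and> (T ^^ per x) x = x" if "x \<in> R" for x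
      using per[OF RP[OF that]] by simp
    show "x = x' \<and> i mod per x = j mod per x"
      if "x \<in> R" "x' \<in> R" "(T ^^ i) x = (T ^^ j) x'" for x x' i j
      using R_eq[OF that] same_mod RP that by metis
    show "\<exists>x\<in>R. \<exists>i<per x. q = (T ^^ i) x" if q: "q \<in> P" for q
    proof -
      obtain x i where x: "x \<in> R" "q = (T ^^ i) x" using P_rep[OF q] by blast
      then have "q = (T ^^ (i mod per x)) x" using modper[OF RP[OF x(1)]] by simp
      then show ?thesis using x(1) per(1)[OF RP[OF x(1)]] by (metis mod_less_divisor not_one_le_zero zero_less_iff_neq_zero)
    qed
  qed
qed

section \<open>Clopen sets of the system\<close>

locale zero_dimensional_system =
  fixes X :: "'a::metric_space set" and T S :: "'a \<Rightarrow> 'a"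
  assumes compact: "compact X"
    and zero_dim: "zero_dimensional (top_of_set X)"
    and homeo: "homeomorphism X X T S"
begin

definition clopen :: "'a set \<Rightarrow> bool" where
  "clopen E \<longleftrightarrow> openin (top_of_set X) E \<and> closedin (top_of_set X) E"

lemma clopen_subset: "clopen E \<Longrightarrow> E \<subseteq> X"
  unfolding clopen_def using openin_imp_subset by blast

lemma clopen_empty: "clopen {}" and clopen_space: "clopen X"
  by (auto simp: clopen_def)

lemma clopen_Int: "clopen A \<Longrightarrow> clopen B \<Longrightarrow> clopen (A \<inter> B)"
  and clopen_Un: "clopen A \<Longrightarrow> clopen B \<Longrightarrow> clopen (A \<union> B)"
  and clopen_Diff: "clopen A \<Longrightarrow> clopen B \<Longrightarrow> clopen (A - B)"
  by (auto simp: clopen_def openin_diff closedin_diff)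

lemma clopen_UN: "finite I \<Longrightarrow> (\<And>i. i \<in> I \<Longrightarrow> clopen (A i)) \<Longrightarrow> clopen (\<Union>i\<in>I. A i)"
  by (induction I rule: finite_induct) (auto simp: clopen_empty clopen_Un)

lemma clopen_INT:
  "finite I \<Longrightarrow> I \<noteq> {} \<Longrightarrow> (\<And>i. i \<in> I \<Longrightarrow> clopen (A i)) \<Longrightarrow> clopen (\<Inter>i\<in>I. A i)"
  by (induction I rule: finite_ne_induct) (auto simp: clopen_Int)

lemma bij: "bij_betw T X X"
  using homeo unfolding homeomorphism_def bij_betw_def by (metis inj_on_inverseI)

lemma homeomorphism_iterate: "homeomorphism X X (T ^^ n) (S ^^ n)"
proof (induction n)
  case 0
  then show ?case by (simp add: homeomorphism_def continuous_on_id)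
next
  case (Suc n)
  have "homeomorphism X X (T \<circ> T ^^ n) (S ^^ n \<circ> S)"
    by (rule homeomorphism_compose[OF Suc homeo])
  then show ?case by (metis funpow.simps(2) funpow_Suc_right)
qed

lemma continuous_iterate: "continuous_on X (T ^^ n)"
  using homeomorphism_iterate homeomorphism_cont1 by blast

lemma clopen_image: "clopen E \<Longrightarrow> clopen ((T ^^ n) ` E)"
  using homeomorphism_imp_open_map[OF homeomorphism_iterate]
    homeomorphism_imp_closed_map[OF homeomorphism_iterate]
  by (simp add: clopen_def)

lemma clopen_preim:
  assumes "clopen E"
  shows "clopen (preim X T n E)"
proof -
  have "preim X T n E = X \<inter> (T ^^ n) -` E" by (auto simp: preim_def)
  moreover have "T ^^ n \<in> X \<rightarrow> X" using funpow_in[OF bij] by auto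
  ultimately show ?thesis
    using assms continuous_openin_preimage[OF continuous_iterate, of n X E]
      continuous_closedin_preimage_gen[OF continuous_iterate, of n X E]
    by (simp add: clopen_def)
qed

lemma clopen_smoothed:
  assumes "clopen W" "0 < N"
  shows "clopen (smoothed X (T ^^ p) N W)"
proof -
  have "preim X (T ^^ p) j E = preim X T (p * j) E" for j E
    by (simp add: preim_def funpow_mult mult.commute)
  moreover have "((T ^^ p) ^^ i) ` W = (T ^^ (p * i)) ` W" for i
    by (simp add: funpow_mult mult.commute)
  ultimately show ?thesis
    unfolding smoothed_def using assms
    by (auto intro!: clopen_INT clopen_UN clopen_preim clopen_image)
qed

text \<open>Zero dimensionality is applied to the cover by open Bowen balls, so that the iterates
  up to time \<open>L\<close> of all parts are small simultaneously. The complement of a part is a union of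
  parts, hence the parts are clopen, and a finite subcover of a partition into nonempty sets is
  the whole partition.\<close>

lemma clopen_partition_mesh:
  assumes "0 < e"
  obtains \<P> where "finite \<P>" "\<Union>\<P> = X" "disjoint \<P>"
    "\<And>A. A \<in> \<P> \<Longrightarrow> clopen A"
    "\<And>A a b i. A \<in> \<P> \<Longrightarrow> a \<in> A \<Longrightarrow> b \<in> A \<Longrightarrow> i \<le> L \<Longrightarrow> dist ((T ^^ i) a) ((T ^^ i) b) < e"
proof -
  define Bowen where
    "Bowen x = (\<Inter>i\<in>{..L}. X \<inter> (T ^^ i) -` ball ((T ^^ i) x) (e / 2))" for x
  have "openin (top_of_set X) (Bowen x)" for x
    unfolding Bowen_def
    by (intro openin_INT2) (auto intro: continuous_openin_preimage_gen[OF continuous_iterate])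
  moreover have "\<Union>(Bowen ` X) = topspace (top_of_set X)"
    using assms by (auto simp: Bowen_def)
  ultimately obtain \<P> where \<P>: "partition_on X \<P>"
      "\<And>A. A \<in> \<P> \<Longrightarrow> openin (top_of_set X) A" "\<And>A. A \<in> \<P> \<Longrightarrow> \<exists>x\<in>X. A \<subseteq> Bowen x"
    using zero_dim[unfolded zero_dimensional_def, rule_format, of "Bowen ` X"]
    by (auto 0 3)
  have un: "\<Union>\<P> = X" and dj: "disjoint \<P>" and ne: "{} \<notin> \<P>"
    using \<P>(1) by (auto simp: partition_on_def)
  have closed: "closedin (top_of_set X) A" if "A \<in> \<P>" for A
  proof -
    have "A = X - \<Union>(\<P> - {A})"
      using that un dj by (auto simp: disjoint_def)
    moreover have "openin (top_of_set X) (\<Union>(\<P> - {A}))" using \<P>(2) by auto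
    ultimately show ?thesis by (metis closedin_diff closedin_topspace topspace_euclidean_subtopology)
  qed
  have "finite \<P>"
  proof -
    obtain \<Q> where \<Q>: "\<Q> \<subseteq> \<P>" "finite \<Q>" "X \<subseteq> \<Union>\<Q>"
      using compact[unfolded compact_eq_openin_cover, rule_format, of \<P>] \<P>(2) un by auto
    have "\<P> \<subseteq> \<Q>"
    proof
      fix A assume A: "A \<in> \<P>"
      then obtain a where "a \<in> A" using ne by fastforce
      then obtain A' where "A' \<in> \<Q>" "a \<in> A'" using \<Q> A un by blast
      then show "A \<in> \<Q>" using A \<open>a \<in> A\<close> dj \<Q>(1)
        by (metis disjointD disjoint_iff subsetD)
    qed
    then show ?thesis using \<Q>(2) finite_subset by blast
  qed
  show ?thesis
  proof (rule that[of \<P>, OF \<open>finite \<P>\<close> un dj])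
    show "clopen A" if "A \<in> \<P>" for A using closed \<P>(2) that by (simp add: clopen_def)
    show "dist ((T ^^ i) a) ((T ^^ i) b) < e" if A: "A \<in> \<P>" "a \<in> A" "b \<in> A" "i \<le> L" for A a b i
    proof -
      obtain x where "A \<subseteq> Bowen x" using \<P>(3) A by blast
      then have "a \<in> Bowen x" "b \<in> Bowen x" using A by auto
      then have "dist ((T ^^ i) x) ((T ^^ i) a) < e / 2" "dist ((T ^^ i) x) ((T ^^ i) b) < e / 2"
        using A(4) by (auto simp: Bowen_def)
      then show ?thesis by (rule dist_triangle_half_r)
    qed
  qed
qed


section \<open>Towers around periodic points\<close>

text \<open>The smoothed set is contained in the union of the first \<open>2N\<close> iterates of \<open>W x\<close> under
  \<open>T\<^sup>p\<close>, where \<open>p\<close> is the period of \<open>x\<close>. So if \<open>W x\<close> follows the orbit of \<open>x\<close> for \<open>2N\<^sup>2 + 2N\<close>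
  steps, its smoothing still does so for \<open>2N\<close> steps. This is enough for the fourth property,
  which says that coincidences between points of the bases within \<open>2N\<close> steps occur only if the
  corresponding periodic points coincide; it makes the floors of the towers disjoint and keeps
  short excursions from leading to a different tower.\<close>

lemma bases_at_periodic_points:
  fixes N :: nat
  defines "P \<equiv> short_periodic X T N"
  assumes N: "0 < N" and e: "0 < e" and fin: "finite P" and RP: "R \<subseteq> P"
    and per: "\<And>x. x \<in> R \<Longrightarrow> 0 < per x \<and> per x < N \<and> (T ^^ per x) x = x"
    and R_eq: "\<And>x x' i j. x \<in> R \<Longrightarrow> x' \<in> R \<Longrightarrow> (T ^^ i) x = (T ^^ j) x' \<Longrightarrow>
       x = x' \<and> i mod per x = j mod per x"
  obtains B where
    "\<And>x. x \<in> R \<Longrightarrow> clopen (B x) \<and> x \<in> B x"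
    "\<And>x. x \<in> R \<Longrightarrow> capturing X (T ^^ per x) N (B x)"
    "\<And>x. x \<in> R \<Longrightarrow> capturing X (T ^^ per x) N (X - B x)"
    "\<And>x x' b b' m m'. x \<in> R \<Longrightarrow> x' \<in> R \<Longrightarrow> b \<in> B x \<Longrightarrow> b' \<in> B x' \<Longrightarrow>
       m \<le> 2 * N \<Longrightarrow> m' \<le> 2 * N \<Longrightarrow> (T ^^ m) b = (T ^^ m') b' \<Longrightarrow>
       x = x' \<and> m mod per x = m' mod per x"
    "\<And>x a b m. x \<in> R \<Longrightarrow> a \<in> B x \<Longrightarrow> b \<in> B x \<Longrightarrow> m \<le> 2 * N \<Longrightarrow>
       dist ((T ^^ m) a) ((T ^^ m) b) < e"
proof -
  have PX: "q \<in> X" if "q \<in> P" for q using that by (simp add: P_def short_periodic_def)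
  have P_iter: "(T ^^ i) q \<in> P" if "q \<in> P" for q i
    using short_periodic_iterate[OF bij] that by (simp add: P_def)
  have R_P: "x \<in> P" if "x \<in> R" for x using RP that by blast
  have modper: "(T ^^ (n mod per x)) x = (T ^^ n) x" if "x \<in> R" for x n
    using per[OF that] by (intro funpow_mod_eq) simp
  (* a partition of mesh below the separation of P has at most one point of P in each part *)
  have "\<exists>d>0. \<forall>qq\<in>P \<times> P. fst qq \<noteq> snd qq \<longrightarrow> d \<le> dist (fst qq) (snd qq)"
  proof (rule finite_uniform_positive)
    show "finite (P \<times> P)" using fin by simp
    show "\<exists>d>0. fst qq \<noteq> snd qq \<longrightarrow> d \<le> dist (fst qq) (snd qq)" for qq :: "'a \<times> 'a"
      by (cases "fst qq = snd qq") (auto intro: exI[of _ 1] exI[of _ "dist (fst qq) (snd qq)"])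
  qed auto
  then obtain d where d: "0 < d" "\<And>q q'. q \<in> P \<Longrightarrow> q' \<in> P \<Longrightarrow> q \<noteq> q' \<Longrightarrow> d \<le> dist q q'"
    by fastforce
  have ed: "0 < min e d" using e d(1) by simp
  obtain \<P> where \<P>: "finite \<P>" "\<Union>\<P> = X" "disjoint \<P>" "\<And>A. A \<in> \<P> \<Longrightarrow> clopen A"
    and mesh: "\<And>A a b i. A \<in> \<P> \<Longrightarrow> a \<in> A \<Longrightarrow> b \<in> A \<Longrightarrow> i \<le> 0 \<Longrightarrow>
                 dist ((T ^^ i) a) ((T ^^ i) b) < min e d"
    by (rule clopen_partition_mesh[OF ed, of 0]) (rule that; assumption)
  have "\<forall>q\<in>P. \<exists>A. A \<in> \<P> \<and> q \<in> A" using \<P>(2) PX by blast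
  then obtain U where U: "\<And>q. q \<in> P \<Longrightarrow> U q \<in> \<P>" "\<And>q. q \<in> P \<Longrightarrow> q \<in> U q" by metis
  have U_unique: "q = q'" if "q \<in> P" "q' \<in> P" "y \<in> U q" "y \<in> U q'" for q q' y
  proof -
    have "U q = U q'" using \<P>(3) U(1) that by (metis disjointD disjoint_iff)
    then have "dist q q' < d" using mesh[of "U q" q q' 0] U[OF that(1)] U(2)[OF that(2)] by simp
    then show ?thesis using d(2) that by fastforce
  qed

  define L where "L = 2 * N * N + 2 * N"
  define W where "W x = (\<Inter>m\<in>{..L}. preim X T m (U ((T ^^ m) x)))" for x
  define B where "B x = smoothed X (T ^^ per x) N (W x)" for x
  have W_clopen: "clopen (W x)" if "x \<in> R" for x
    unfolding W_def using \<P>(4) U(1) P_iter[OF R_P[OF that]] by (intro clopen_INT clopen_preim) auto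
  have x_W: "x \<in> W x" if "x \<in> R" for x
    using U(2) P_iter[OF R_P[OF that]] PX[OF R_P[OF that]] by (auto simp: W_def mem_preim)
  have B_clopen: "clopen (B x)" if "x \<in> R" for x
    unfolding B_def by (rule clopen_smoothed[OF W_clopen[OF that] N])
  have x_B: "x \<in> B x" if "x \<in> R" for x
  proof -
    have "((T ^^ per x) ^^ j) x = x" for j
      using per[OF that] by (induction j) auto
    then show ?thesis
      using x_W[OF that] PX[OF R_P[OF that]] N unfolding B_def smoothed_mem[OF N]
      by (auto intro!: exI[of _ 0])
  qed
  have track: "(T ^^ m) b \<in> U ((T ^^ m) x)" if x: "x \<in> R" and b: "b \<in> B x" and m: "m \<le> 2 * N"
    for x b m
  proof -
    obtain i w where i: "i < 2 * N" "w \<in> W x" "b = ((T ^^ per x) ^^ i) w"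
      using b N unfolding B_def smoothed_mem[OF N] by (metis funpow_0 imageE)
    have eq: "(T ^^ m) b = (T ^^ (m + per x * i)) w"
      using i(3) by (simp add: funpow_mult funpow_plus mult.commute)
    have "per x * i \<le> N * (2 * N)"
      using i(1) per[OF x] by (intro mult_mono) auto
    then have "m + per x * i \<le> L" using m by (simp add: L_def)
    then have "(T ^^ m) b \<in> U ((T ^^ (m + per x * i)) x)"
      using i(2) unfolding eq W_def by (auto simp: mem_preim)
    moreover have "(T ^^ (m + per x * i)) x = (T ^^ m) x"
      using modper[OF x, of "m + per x * i"] modper[OF x, of m] by simp
    ultimately show ?thesis by simp
  qed
  have meet: "x = x' \<and> m mod per x = m' mod per x"
    if x: "x \<in> R" "x' \<in> R" and b: "b \<in> B x" "b' \<in> B x'" and m: "m \<le> 2 * N" "m' \<le> 2 * N"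
      and eq: "(T ^^ m) b = (T ^^ m') b'" for x x' b b' m m'
  proof -
    have "(T ^^ m) b \<in> U ((T ^^ m) x)" "(T ^^ m) b \<in> U ((T ^^ m') x')"
      using track[OF x(1) b(1) m(1)] track[OF x(2) b(2) m(2)] eq by auto
    then have "(T ^^ m) x = (T ^^ m') x'" using U_unique P_iter R_P x by blast
    then show ?thesis by (rule R_eq[OF x])
  qed

  show ?thesis
  proof (rule that[of B])
    have bijp: "bij_betw (T ^^ per x) X X" for x by (rule bij_betw_funpow_on[OF bij])
    show "clopen (B x) \<and> x \<in> B x" if "x \<in> R" for x using B_clopen x_B that by blast
    show "capturing X (T ^^ per x) N (B x)" if "x \<in> R" for x
      unfolding B_def by (rule capturing_smoothed[OF bijp clopen_subset[OF W_clopen[OF that]] N])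
    show "capturing X (T ^^ per x) N (X - B x)" for x
      unfolding B_def by (rule capturing_compl_smoothed[OF bijp N])
    show "x = x' \<and> m mod per x = m' mod per x"
      if "x \<in> R" "x' \<in> R" "b \<in> B x" "b' \<in> B x'" "m \<le> 2 * N" "m' \<le> 2 * N"
        "(T ^^ m) b = (T ^^ m') b'" for x x' b b' m m'
      by (rule meet[OF that])
    show "dist ((T ^^ m) a) ((T ^^ m) b) < e"
      if x: "x \<in> R" "a \<in> B x" "b \<in> B x" "m \<le> 2 * N" for x a b m
      using mesh[OF U(1)[OF P_iter[OF R_P[OF x(1)]]], of _ m _ 0]
        track[OF x(1,2,4)] track[OF x(1,3,4)] by simp
  qed
qed

text \<open>For the capturing property of the complement, consider an orbit that has just left the tower
  over \<open>B x\<close>. It left the top floor without returning to \<open>B x\<close>, so it misses \<open>B x\<close> at the times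
  \<open>0, p, \<dots>, (N - 1)p\<close> from then on, where \<open>p\<close> is the period of \<open>x\<close>. As it is still close to the orbit of \<open>x\<close>, it can neither
  be in a tower around another periodic orbit, nor be in the same tower except at the floor
  prescribed by the time modulo the period, which would bring it back to \<open>B x\<close> at one of these
  times.\<close>

lemma small_castle_at_short_periods:
  assumes N: "0 < N" and e: "0 < e" and fin: "finite (short_periodic X T N)"
  obtains \<C> where "finite \<C>" "castle X T \<C>"
    "\<And>B l. (B, l) \<in> \<C> \<Longrightarrow> clopen B \<and> capturing X T N (tower T B l)"
    "\<And>B l i a b. (B, l) \<in> \<C> \<Longrightarrow> i < l \<Longrightarrow> a \<in> B \<Longrightarrow> b \<in> B \<Longrightarrow>
       dist ((T ^^ i) a) ((T ^^ i) b) < e"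
    "capturing X T N (X - (\<Union>(B, l)\<in>\<C>. tower T B l))"
    "short_periodic X T N \<subseteq> (\<Union>(B, l)\<in>\<C>. tower T B l)"
proof -
  obtain R per where RP: "R \<subseteq> short_periodic X T N"
    and per: "\<And>x. x \<in> R \<Longrightarrow> 0 < per x \<and> per x < N \<and> (T ^^ per x) x = x"
    and R_eq: "\<And>x x' i j. x \<in> R \<Longrightarrow> x' \<in> R \<Longrightarrow> (T ^^ i) x = (T ^^ j) x' \<Longrightarrow>
       x = x' \<and> i mod per x = j mod per x"
    and P_rep: "\<And>q. q \<in> short_periodic X T N \<Longrightarrow> \<exists>x\<in>R. \<exists>i<per x. q = (T ^^ i) x"
    by (rule orbit_representatives[OF bij, of N]) (rule that; assumption)
  obtain B where
    B: "\<And>x. x \<in> R \<Longrightarrow> clopen (B x) \<and> x \<in> B x"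
    and B_cap: "\<And>x. x \<in> R \<Longrightarrow> capturing X (T ^^ per x) N (B x)"
    and B_compl: "\<And>x. x \<in> R \<Longrightarrow> capturing X (T ^^ per x) N (X - B x)"
    and meet: "\<And>x x' b b' m m'. x \<in> R \<Longrightarrow> x' \<in> R \<Longrightarrow> b \<in> B x \<Longrightarrow> b' \<in> B x' \<Longrightarrow>
       m \<le> 2 * N \<Longrightarrow> m' \<le> 2 * N \<Longrightarrow> (T ^^ m) b = (T ^^ m') b' \<Longrightarrow>
       x = x' \<and> m mod per x = m' mod per x"
    and small: "\<And>x a b m. x \<in> R \<Longrightarrow> a \<in> B x \<Longrightarrow> b \<in> B x \<Longrightarrow> m \<le> 2 * N \<Longrightarrow>
       dist ((T ^^ m) a) ((T ^^ m) b) < e"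
    by (rule bases_at_periodic_points[OF N e fin RP per R_eq]) (assumption+, (rule that; assumption))
  define \<C> where "\<C> = (\<lambda>x. (B x, per x)) ` R"
  define K where "K = (\<Union>(B, l)\<in>\<C>. tower T B l)"
  have K: "y \<in> K \<longleftrightarrow> (\<exists>x\<in>R. y \<in> tower T (B x) (per x))" for y
    by (auto simp: K_def \<C>_def)
  have bijp: "bij_betw (T ^^ per x) X X" for x by (rule bij_betw_funpow_on[OF bij])
  have BX: "B x \<subseteq> X" if "x \<in> R" for x using clopen_subset B that by blast
  have perR: "0 < per x" "per x < N" if "x \<in> R" for x using per[OF that] by auto
  show ?thesis
  proof (rule that[of \<C>])
    show "finite \<C>" using finite_subset[OF RP fin] by (simp add: \<C>_def)
    show "castle X T \<C>"
      unfolding castle_def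
    proof (intro conjI ballI)
      fix c assume "c \<in> \<C>"
      then obtain x where x: "x \<in> R" "c = (B x, per x)" by (auto simp: \<C>_def)
      have *: False if "b \<in> B x" "(T ^^ i) b \<in> B x" "i \<in> {1..per x - 1}" for b i
      proof -
        have i: "0 < i" "i < per x" "i \<le> 2 * N" using that(3) perR[OF x(1)] by auto
        then have "i mod per x = 0"
          using meet[OF x(1) x(1) that(1,2), of i 0] by simp
        then show False using i by simp
      qed
      then have "B x \<inter> preim X T i (B x) = {}" if "i \<in> {1..per x - 1}" for i
        using * that unfolding preim_def by blast
      then have "is_tower X T (B x) (per x)"
        unfolding is_tower_def using perR[OF x(1)] BX[OF x(1)] by simp
      then show "case c of (B, l) \<Rightarrow> is_tower X T B l" using x by simp
    next
      have "x = x'" if xx: "x \<in> R" "x' \<in> R" "y \<in> tower T (B x) (per x)" "y \<in> tower T (B x') (per x')"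
        for x x' y
      proof -
        obtain b i where b: "b \<in> B x" "i < per x" "y = (T ^^ i) b"
          using xx(3) by (rule tower_memE)
        obtain b' i' where b': "b' \<in> B x'" "i' < per x'" "y = (T ^^ i') b'"
          using xx(4) by (rule tower_memE)
        show ?thesis
          using meet[OF xx(1,2) b(1) b'(1), of i i'] perR[OF xx(1)] perR[OF xx(2)] b b' by simp
      qed
      then have "tower T (B x) (per x) \<inter> tower T (B x') (per x') = {}"
        if "x \<in> R" "x' \<in> R" "(B x, per x) \<noteq> (B x', per x')" for x x'
        using that by blast
      then show "disjoint_family_on (\<lambda>(B, l). tower T B l) \<C>"
        unfolding disjoint_family_on_def \<C>_def by simp
    qed
    show "clopen C \<and> capturing X T N (tower T C l)" if C: "(C, l) \<in> \<C>" for C l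
    proof -
      obtain x where x: "x \<in> R" "C = B x" "l = per x" using C by (auto simp: \<C>_def)
      then show ?thesis
        using x B[OF x(1)] capturing_tower_low[OF BX[OF x(1)] B_cap[OF x(1)] perR(1)[OF x(1)]] by simp
    qed
    show "dist ((T ^^ i) a) ((T ^^ i) b) < e" if C: "(C, l) \<in> \<C>" "i < l" "a \<in> C" "b \<in> C" for C l i a b
    proof -
      obtain x where x: "x \<in> R" "C = B x" "l = per x" using C(1) by (auto simp: \<C>_def)
      have "i \<le> 2 * N" using C(2) x perR[OF x(1)] by simp
      then show ?thesis using small[OF x(1), of a b i] C x by simp
    qed
    show "capturing X T N (X - (\<Union>(B, l)\<in>\<C>. tower T B l))"
      unfolding K_def[symmetric]
    proof (rule capturingI)
      fix y n assume y: "y \<in> X - K" "y \<notin> T ` (X - K)" and n: "n < N"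
      obtain z where z: "z \<in> X" "T z = y" using funpow_surj[OF bij, of y 1] y by auto
      then have "z \<in> K" using y(2) by blast
      then obtain x where x: "x \<in> R" "z \<in> tower T (B x) (per x)" by (auto simp: K)
      obtain b i where b: "b \<in> B x" "i < per x" "z = (T ^^ i) b" using x(2) by (rule tower_memE)
      have yb: "y = (T ^^ Suc i) b" using z b by simp
      have "Suc i = per x"
      proof (rule ccontr)
        assume "Suc i \<noteq> per x"
        then have "y \<in> tower T (B x) (per x)" using b yb by (intro tower_memI[of b _ "Suc i"]) auto
        then show False using y(1) x(1) K by blast
      qed
      then have ypb: "y = (T ^^ per x) b" using yb by simp
      have "y \<notin> B x" using y(1) x(1) K tower_memI[of y "B x" 0 "per x" y T] perR[OF x(1)] by auto
      moreover have "y \<notin> (T ^^ per x) ` (X - B x)"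
      proof
        assume "y \<in> (T ^^ per x) ` (X - B x)"
        then obtain c where c: "c \<in> X - B x" "(T ^^ per x) c = (T ^^ per x) b" using ypb by auto
        then have "c = b" using funpow_cancel[OF bij, of c b "per x" "per x"] BX[OF x(1)] b(1) by auto
        then show False using b(1) c(1) by simp
      qed
      moreover have "capturing X (T ^^ per x) N (X - B x)"
        by (rule B_compl[OF x(1)])
      ultimately have away: "((T ^^ per x) ^^ j) y \<notin> B x" if "j < N" for j
        using capturingD[of X "T ^^ per x" N "X - B x" y j] y(1) that by auto
      have "(T ^^ n) y \<notin> K"
      proof
        assume "(T ^^ n) y \<in> K"
        then obtain x' where x': "x' \<in> R" "(T ^^ n) y \<in> tower T (B x') (per x')" by (auto simp: K)
        obtain b' i' where b': "b' \<in> B x'" "i' < per x'" "(T ^^ n) y = (T ^^ i') b'"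
          using x'(2) by (rule tower_memE)
        have "(T ^^ (n + per x)) b = (T ^^ i') b'" using b'(3) ypb by (simp add: funpow_plus)
        then have *: "x = x' \<and> (n + per x) mod per x = i' mod per x"
          using n b'(2) perR[OF x(1)] perR[OF x'(1)]
          by (intro meet[OF x(1) x'(1) b(1) b'(1)]) auto
        then have xx: "x = x'" by blast
        have "n mod per x = i' mod per x" using conjunct2[OF *] by simp
        moreover have "i' < per x" using b'(2) xx by simp
        ultimately have i': "i' = n mod per x" by simp
        define c where "c = ((T ^^ per x) ^^ (n div per x)) y"
        have "(T ^^ i') c = (T ^^ n) y"
          by (simp add: c_def i' funpow_mult funpow_plus)
        moreover have "c \<in> X" using funpow_in[OF bijp] y(1) by (auto simp: c_def)
        ultimately have "c = b'"
          using funpow_cancel[OF bij, of c b' i' i'] b' BX[OF x'(1)] by auto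
        moreover have "n div per x < N" using n by (meson div_le_dividend le_less_trans)
        ultimately show False using away b'(1) xx by (auto simp: c_def)
      qed
      then show "y \<in> X \<and> (T ^^ n) y \<in> X - K" using y(1) funpow_in[OF bij] by auto
    qed
    show "short_periodic X T N \<subseteq> (\<Union>(B, l)\<in>\<C>. tower T B l)"
      unfolding K_def[symmetric]
    proof
      fix q assume "q \<in> short_periodic X T N"
      then obtain x i where x: "x \<in> R" "i < per x" "q = (T ^^ i) x" using P_rep by blast
      then have "q \<in> tower T (B x) (per x)" using B tower_memI[of x "B x" i "per x" q T] by blast
      then show "q \<in> K" using x(1) K by blast
    qed
  qed
qed

section \<open>Markers and return times\<close>

text \<open>By compactness, points of \<open>Y\<close> are moved by at least some \<open>e > 0\<close> by each of \<open>T, \<dots>, T\<^sup>N\<^sup>-\<^sup>1\<close>,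
  so a clopen partition of mesh less than \<open>e\<close> consists of sets whose points in \<open>Y\<close> may serve as
  markers simultaneously. Starting with the entry points of \<open>Y\<close>, which are separated because \<open>Y\<close>
  is capturing, the parts are processed one after another, each contributing those
  admissible points that have no earlier marker within distance less than \<open>N\<close> on their orbit.
  A point is admissible if it stays in \<open>Y\<close> for \<open>N\<close> steps; in the end each of these has a marker
  nearby.\<close>

lemma clopen_marker:
  assumes N: "0 < N" and Y: "clopen Y" and cap: "capturing X T N Y"
    and aper: "Y \<inter> short_periodic X T N = {}"
  obtains F where "clopen F" "Y - T ` Y \<subseteq> F"
    "\<And>y n. y \<in> F \<Longrightarrow> n < N \<Longrightarrow> (T ^^ n) y \<in> Y"
    "\<And>y i. y \<in> F \<Longrightarrow> 0 < i \<Longrightarrow> i < N \<Longrightarrow> (T ^^ i) y \<notin> F"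
    "\<And>y. y \<in> X \<Longrightarrow> \<forall>n<N. (T ^^ n) y \<in> Y \<Longrightarrow>
       \<exists>i<N. (T ^^ i) y \<in> F \<or> y \<in> (T ^^ i) ` F"
proof -
  have YX: "Y \<subseteq> X" by (rule clopen_subset[OF Y])
  have "\<exists>e>0. \<forall>i\<in>{1..<N}. \<forall>y\<in>Y. e \<le> dist y ((T ^^ i) y)"
  proof (rule finite_uniform_positive)
    fix i assume i: "i \<in> {1..<N}"
    show "\<exists>e>0. \<forall>y\<in>Y. e \<le> dist y ((T ^^ i) y)"
    proof (cases "Y = {}")
      case False
      have "compact Y" using Y compact closedin_compact by (auto simp: clopen_def)
      moreover have "continuous_on Y (\<lambda>y. dist y ((T ^^ i) y))"
        by (intro continuous_intros continuous_on_subset[OF continuous_iterate YX])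
      ultimately obtain y where y: "y \<in> Y" "\<And>z. z \<in> Y \<Longrightarrow> dist y ((T ^^ i) y) \<le> dist z ((T ^^ i) z)"
        using continuous_attains_inf[OF _ False] by blast
      have "(T ^^ i) y \<noteq> y"
        using aper y(1) YX i by (auto simp: short_periodic_def has_period_def)
      then show ?thesis using y(2) by (intro exI[of _ "dist y ((T ^^ i) y)"]) auto
    qed (auto intro: exI[of _ 1])
  qed (auto intro: order_trans)
  then obtain e where e: "0 < e" "\<And>i y. 0 < i \<Longrightarrow> i < N \<Longrightarrow> y \<in> Y \<Longrightarrow> e \<le> dist y ((T ^^ i) y)"
    by (auto simp: Suc_le_eq)
  obtain \<P> where \<P>: "finite \<P>" "\<Union>\<P> = X" "disjoint \<P>" "\<And>A. A \<in> \<P> \<Longrightarrow> clopen A"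
    and mesh: "\<And>A a b i. A \<in> \<P> \<Longrightarrow> a \<in> A \<Longrightarrow> b \<in> A \<Longrightarrow> i \<le> 0 \<Longrightarrow>
                 dist ((T ^^ i) a) ((T ^^ i) b) < e"
    by (rule clopen_partition_mesh[OF e(1), of 0]) (rule that; assumption)
  have mesh0: "dist a b < e" if "A \<in> \<P>" "a \<in> A" "b \<in> A" for A a b
    using mesh[OF that, of 0] by simp
  define Z where "Z = (\<Inter>n\<in>{..<N}. preim X T n Y)"
  have Z: "y \<in> Z \<longleftrightarrow> y \<in> X \<and> (\<forall>n<N. (T ^^ n) y \<in> Y)" for y
    using N by (auto simp: Z_def mem_preim)
  have Z_clopen: "clopen Z" unfolding Z_def using N Y by (intro clopen_INT clopen_preim) auto
  have ZY: "Z \<subseteq> Y" using Z N by (metis funpow_0 subsetI)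
  have "\<exists>F. clopen F \<and> Y - T ` Y \<subseteq> F \<and> F \<subseteq> Z \<and>
            (\<forall>y\<in>F. \<forall>i. 0 < i \<and> i < N \<longrightarrow> (T ^^ i) y \<notin> F) \<and>
            (\<forall>A\<in>\<A>. \<forall>y\<in>A \<inter> Z. \<exists>i<N. (T ^^ i) y \<in> F \<or> y \<in> (T ^^ i) ` F)"
    if "finite \<A>" "\<A> \<subseteq> \<P>" for \<A>
    using that
  proof (induction \<A> rule: finite_induct)
    case empty
    have "clopen (Y - T ` Y)" using clopen_Diff[OF Y clopen_image[OF Y, of 1]] by simp
    moreover have stay: "(T ^^ n) y \<in> Y" if "y \<in> Y - T ` Y" "n < N" for y n
      using capturingD[OF cap] that by blast
    moreover have "(T ^^ i) y \<notin> Y - T ` Y" if "y \<in> Y - T ` Y" "0 < i" "i < N" for y i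
    proof -
      have "(T ^^ (i - 1)) y \<in> Y" using stay[OF that(1), of "i - 1"] that by auto
      moreover have "(T ^^ i) y = T ((T ^^ (i - 1)) y)" using that(2) by (cases i) auto
      ultimately show ?thesis by blast
    qed
    ultimately show ?case using YX by (intro exI[of _ "Y - T ` Y"]) (auto simp: Z)
  next
    case (insert A \<A>)
    then obtain F where F: "clopen F" "Y - T ` Y \<subseteq> F" "F \<subseteq> Z"
      and sep: "\<And>y i. y \<in> F \<Longrightarrow> 0 < i \<Longrightarrow> i < N \<Longrightarrow> (T ^^ i) y \<notin> F"
      and near: "\<And>A y. A \<in> \<A> \<Longrightarrow> y \<in> A \<Longrightarrow> y \<in> Z \<Longrightarrow> \<exists>i<N. (T ^^ i) y \<in> F \<or> y \<in> (T ^^ i) ` F"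
      by (auto 0 4)
    have A: "A \<in> \<P>" using insert by simp
    define V where "V = A \<inter> Z - (\<Union>i\<in>{..<N}. preim X T i F \<union> (T ^^ i) ` F)"
    have V: "y \<in> V \<longleftrightarrow> y \<in> A \<and> y \<in> Z \<and> \<not> (\<exists>i<N. (T ^^ i) y \<in> F \<or> y \<in> (T ^^ i) ` F)" for y
      by (auto simp: V_def mem_preim Z)
    have "clopen (F \<union> V)"
      unfolding V_def using F(1) \<P>(4)[OF A] Z_clopen
      by (intro clopen_Un clopen_Diff clopen_Int clopen_UN clopen_preim clopen_image) auto
    moreover have sep': "(T ^^ i) y \<notin> F \<union> V" if y: "y \<in> F \<union> V" and i: "0 < i" "i < N" for y i
    proof
      assume "(T ^^ i) y \<in> F \<union> V"
      then consider "y \<in> F" "(T ^^ i) y \<in> F" | "y \<in> V" "(T ^^ i) y \<in> F"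
        | "y \<in> F" "(T ^^ i) y \<in> V" | "y \<in> V" "(T ^^ i) y \<in> V"
        using y by blast
      then show False
      proof cases
        case 1
        then show False using sep i by blast
      next
        case 2
        then show False using V i by blast
      next
        case 3
        then show False using V i by blast
      next
        case 4
        then have "y \<in> Y" "y \<in> A" "(T ^^ i) y \<in> A" using V ZY by auto
        then show False using e(2)[OF i] mesh0[OF A] by fastforce
      qed
    qed
    moreover have near': "\<exists>i<N. (T ^^ i) y \<in> F \<union> V \<or> y \<in> (T ^^ i) ` (F \<union> V)"
      if "C \<in> insert A \<A>" "y \<in> C \<inter> Z" for C y
    proof (cases "y \<in> V")
      case True
      then show ?thesis using N by (intro exI[of _ 0]) auto
    next
      case False
      then have "\<exists>i<N. (T ^^ i) y \<in> F \<or> y \<in> (T ^^ i) ` F"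
        using that near V by blast
      then show ?thesis by blast
    qed
    moreover have "Y - T ` Y \<subseteq> F \<union> V" "F \<union> V \<subseteq> Z" using F(2,3) V by blast+
    ultimately show ?case by (intro exI[of _ "F \<union> V"] conjI ballI allI impI) simp_all
  qed
  from this[OF \<P>(1) subset_refl] obtain F where F: "clopen F" "Y - T ` Y \<subseteq> F" "F \<subseteq> Z"
      "\<And>y i. y \<in> F \<Longrightarrow> 0 < i \<Longrightarrow> i < N \<Longrightarrow> (T ^^ i) y \<notin> F"
      "\<And>A y. A \<in> \<P> \<Longrightarrow> y \<in> A \<Longrightarrow> y \<in> Z \<Longrightarrow> \<exists>i<N. (T ^^ i) y \<in> F \<or> y \<in> (T ^^ i) ` F"
    by (auto 0 4)
  show ?thesis
  proof (rule that[OF F(1,2) _ F(4)])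
    show "(T ^^ n) y \<in> Y" if "y \<in> F" "n < N" for y n using that F(3) Z by blast
    show "\<exists>i<N. (T ^^ i) y \<in> F \<or> y \<in> (T ^^ i) ` F"
      if y: "y \<in> X" "\<forall>n<N. (T ^^ n) y \<in> Y" for y
    proof -
      have "y \<in> Z" using y Z by blast
      moreover obtain A where "A \<in> \<P>" "y \<in> A" using y(1) \<P>(2) by blast
      ultimately show ?thesis using F(5) by blast
    qed
  qed
qed

text \<open>Trace \<open>y\<close> back for \<open>2N\<close> steps. If the orbit enters \<open>Y\<close> on the way, the last entry point is a
  marker. Otherwise the point \<open>N\<close> steps back is admissible, and so has a marker less than
  \<open>N\<close> steps before or after it.\<close>

lemma marker_in_recent_past:
  assumes Y: "Y \<subseteq> X" and F: "F \<subseteq> Y" "Y - T ` Y \<subseteq> F"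
    and near: "\<And>y. y \<in> X \<Longrightarrow> \<forall>n<N. (T ^^ n) y \<in> Y \<Longrightarrow>
       \<exists>i<N. (T ^^ i) y \<in> F \<or> y \<in> (T ^^ i) ` F"
    and y: "y \<in> Y"
  shows "\<exists>n\<le>2 * N. \<exists>f\<in>F. (T ^^ n) f = y \<and> (\<forall>m\<le>n. (T ^^ m) f \<in> Y)"
proof -
  obtain z where z: "z \<in> X" "(T ^^ (2 * N)) z = y" using funpow_surj[OF bij] y Y by blast
  have rest: "(T ^^ (2 * N - k)) ((T ^^ k) z) = y" if "k \<le> 2 * N" for k
    using that z(2) by (simp add: funpow_plus)
  show ?thesis
  proof (cases "\<forall>k\<le>2 * N. (T ^^ k) z \<in> Y")
    case True
    then have "\<forall>n<N. (T ^^ n) ((T ^^ N) z) \<in> Y" by (simp add: funpow_plus)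
    then obtain i where i: "i < N" "(T ^^ i) ((T ^^ N) z) \<in> F \<or> (T ^^ N) z \<in> (T ^^ i) ` F"
      using near[of "(T ^^ N) z"] funpow_in[OF bij z(1)] by blast
    have "\<exists>k\<le>2 * N. (T ^^ k) z \<in> F"
      using i(2)
    proof
      assume "(T ^^ i) ((T ^^ N) z) \<in> F"
      then show ?thesis using i(1) by (intro exI[of _ "i + N"]) (simp add: funpow_plus)
    next
      assume "(T ^^ N) z \<in> (T ^^ i) ` F"
      then obtain f where f: "f \<in> F" "(T ^^ i) f = (T ^^ N) z" by auto
      then have "f = (T ^^ (N - i)) z"
        using funpow_cancel[OF bij _ z(1) f(2)] i(1) F(1) Y by auto
      then show ?thesis using f(1) by (intro exI[of _ "N - i"]) simp
    qed
    then obtain k where k: "k \<le> 2 * N" "(T ^^ k) z \<in> F" by blast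
    have "(T ^^ m) ((T ^^ k) z) \<in> Y" if "m \<le> 2 * N - k" for m
      using True that k(1) by (simp add: funpow_plus)
    then show ?thesis using rest[OF k(1)] k(2) by (intro exI[of _ "2 * N - k"]) auto
  next
    case False
    define bad where "bad = {k. k \<le> 2 * N \<and> (T ^^ k) z \<notin> Y}"
    have "finite bad" "bad \<noteq> {}" using False by (auto simp: bad_def)
    define k where "k = Max bad"
    have k: "k \<le> 2 * N" "(T ^^ k) z \<notin> Y"
      using Max_in[OF \<open>finite bad\<close> \<open>bad \<noteq> {}\<close>] by (auto simp: k_def bad_def)
    have after: "(T ^^ j) z \<in> Y" if "k < j" "j \<le> 2 * N" for j
      using Max_ge[OF \<open>finite bad\<close>, of j] that by (fastforce simp: k_def bad_def)
    have "k \<noteq> 2 * N" using k(2) z(2) y by auto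
    then have k': "Suc k \<le> 2 * N" using k(1) by simp
    have "(T ^^ Suc k) z \<notin> T ` Y"
    proof
      assume "(T ^^ Suc k) z \<in> T ` Y"
      then obtain u where "u \<in> Y" "T ((T ^^ k) z) = T u" by auto
      then have "(T ^^ k) z = u"
        using bij funpow_in[OF bij z(1)] Y by (auto simp: bij_betw_def inj_on_def)
      then show False using k(2) \<open>u \<in> Y\<close> by simp
    qed
    then have "(T ^^ Suc k) z \<in> F" using F(2) after[OF _ k'] by blast
    moreover have "(T ^^ m) ((T ^^ Suc k) z) \<in> Y" if "m \<le> 2 * N - Suc k" for m
      using after[of "m + Suc k"] that k' by (simp only: funpow_plus)
    ultimately show ?thesis using rest[OF k'] by (intro exI[of _ "2 * N - Suc k"]) auto
  qed
qed

text \<open>The base of the towers of height \<open>r\<close> is the set \<open>G r\<close> of markers whose first positive time in \<open>Q\<close>,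
  the set of markers and of points outside \<open>Y\<close>, is \<open>r\<close>. It is clopen because only finitely
  many times are involved.\<close>

lemma high_castle_without_short_periods:
  assumes N: "0 < N" and e: "0 < e" and Y: "clopen Y" and cap: "capturing X T N Y"
    and aper: "Y \<inter> short_periodic X T N = {}"
  obtains \<C> where "finite \<C>" "castle X T \<C>"
    "\<And>B l. (B, l) \<in> \<C> \<Longrightarrow> clopen B \<and> N \<le> l"
    "\<And>B l i a b. (B, l) \<in> \<C> \<Longrightarrow> i < l \<Longrightarrow> a \<in> B \<Longrightarrow> b \<in> B \<Longrightarrow>
       dist ((T ^^ i) a) ((T ^^ i) b) < e"
    "(\<Union>(B, l)\<in>\<C>. tower T B l) = Y"
proof -
  have YX: "Y \<subseteq> X" by (rule clopen_subset[OF Y])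
  obtain F where F: "clopen F" "Y - T ` Y \<subseteq> F"
    and F_stay: "\<And>y n. y \<in> F \<Longrightarrow> n < N \<Longrightarrow> (T ^^ n) y \<in> Y"
    and F_sep: "\<And>y i. y \<in> F \<Longrightarrow> 0 < i \<Longrightarrow> i < N \<Longrightarrow> (T ^^ i) y \<notin> F"
    and F_near: "\<And>y. y \<in> X \<Longrightarrow> \<forall>n<N. (T ^^ n) y \<in> Y \<Longrightarrow>
       \<exists>i<N. (T ^^ i) y \<in> F \<or> y \<in> (T ^^ i) ` F"
    by (rule clopen_marker[OF N Y cap aper]) (rule that; assumption)
  have FY: "F \<subseteq> Y" using F_stay[OF _ N] by auto
  have past: "\<exists>n\<le>2 * N. \<exists>f\<in>F. (T ^^ n) f = y \<and> (\<forall>m\<le>n. (T ^^ m) f \<in> Y)" if "y \<in> Y" for y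
    by (rule marker_in_recent_past[OF YX FY F(2) _ that]) (rule F_near; assumption)
  obtain \<P> where \<P>: "finite \<P>" "\<Union>\<P> = X" "disjoint \<P>" "\<And>A. A \<in> \<P> \<Longrightarrow> clopen A"
    and mesh: "\<And>A a b i. A \<in> \<P> \<Longrightarrow> a \<in> A \<Longrightarrow> b \<in> A \<Longrightarrow> i \<le> 2 * N + 1 \<Longrightarrow>
                 dist ((T ^^ i) a) ((T ^^ i) b) < e"
    by (rule clopen_partition_mesh[OF e, of "2 * N + 1"]) (rule that; assumption)
  define Q where "Q = F \<union> (X - Y)"
  have Q_clopen: "clopen Q" unfolding Q_def by (intro clopen_Un clopen_Diff F(1) clopen_space Y)
  define G where "G r = (F \<inter> preim X T r Q) - (\<Union>i\<in>{1..<r}. preim X T i Q)" for r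
  have G: "y \<in> G r \<longleftrightarrow> y \<in> F \<and> (T ^^ r) y \<in> Q \<and> (\<forall>i. 0 < i \<and> i < r \<longrightarrow> (T ^^ i) y \<notin> Q)" for y r
    using FY YX by (auto simp: G_def mem_preim Suc_le_eq)
  have G_clopen: "clopen (G r)" for r
    unfolding G_def using F(1) Q_clopen
    by (intro clopen_Diff clopen_Int clopen_UN clopen_preim) auto
  have GX: "G r \<subseteq> X" for r by (rule clopen_subset[OF G_clopen])
  have G_floor: "(T ^^ i) y \<in> Y" if "y \<in> G r" "i < r" for y r i
  proof (cases "i = 0")
    case True
    then show ?thesis using that G FY by auto
  next
    case False
    then have "(T ^^ i) y \<notin> Q" using that G by blast
    moreover have "(T ^^ i) y \<in> X" using funpow_in[OF bij] that(1) GX by blast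
    ultimately show ?thesis by (simp add: Q_def)
  qed
  have G_unique: "r = r' \<and> y = y'"
    if y: "y \<in> G r" "y' \<in> G r'" "i < r" "i' < r'" "(T ^^ i) y = (T ^^ i') y'" for y y' r r' i i'
  proof -
    have *: "y = y'"
      if y: "y \<in> G r" "y' \<in> G r'" "i \<le> i'" "i' < r'" "(T ^^ i) y = (T ^^ i') y'" for y y' r r' i i'
    proof -
      have eq: "y = (T ^^ (i' - i)) y'"
        using funpow_cancel[OF bij _ _ y(5,3)] y(1,2) GX by blast
      have "y \<in> Q" using y(1) G by (simp add: Q_def)
      then have "\<not> (0 < i' - i \<and> i' - i < r')" using y(2) eq G by blast
      then have "i' - i = 0" using y(4) by linarith
      then show ?thesis using eq by simp
    qed
    have yy: "y = y'"
    proof (cases "i \<le> i'")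
      case True
      then show ?thesis using *[OF y(1,2) True y(4,5)] by simp
    next
      case False
      then show ?thesis using *[OF y(2,1) _ y(3) y(5)[symmetric]] by simp
    qed
    have "\<not> r < r'" "\<not> r' < r" using y yy G by (metis gr_zeroI not_less0)+
    then show ?thesis using yy by simp
  qed
  (* if y had not returned to Q by time 2 * N + 1, its iterate at that time would be in Y without
     a marker in its recent past *)
  have return: "\<exists>r. N \<le> r \<and> r \<le> 2 * N + 1 \<and> y \<in> G r" if y: "y \<in> F" for y
  proof -
    define ret where "ret r \<longleftrightarrow> 0 < r \<and> (T ^^ r) y \<in> Q" for r
    have yX: "y \<in> X" using y FY YX by blast
    have "\<exists>r. ret r \<and> r \<le> 2 * N + 1"
    proof (rule ccontr)
      assume none: "\<not> ?thesis"
      have "(T ^^ (2 * N + 1)) y \<notin> Q" using none by (auto simp: ret_def simp del: funpow.simps)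
      then have "(T ^^ (2 * N + 1)) y \<in> Y"
        using funpow_in[OF bij yX, of "2 * N + 1"] by (simp add: Q_def)
      then obtain n f where f: "n \<le> 2 * N" "f \<in> F" "(T ^^ n) f = (T ^^ (2 * N + 1)) y"
        using past by blast
      then have "f = (T ^^ (2 * N + 1 - n)) y"
        using funpow_cancel[OF bij _ yX f(3)] FY YX by auto
      then have "ret (2 * N + 1 - n)" using f(1,2) by (auto simp: ret_def Q_def)
      then show False using none by auto
    qed
    then obtain r0 where r0: "ret r0" "r0 \<le> 2 * N + 1" by blast
    define r where "r = (LEAST r. ret r)"
    have r: "ret r" "r \<le> r0" unfolding r_def using r0(1) by (auto intro: LeastI Least_le)
    have "y \<in> G r"
      unfolding G using y r(1) not_less_Least[of _ ret] by (auto simp: ret_def r_def)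
    moreover have "N \<le> r"
    proof (rule ccontr)
      assume "\<not> N \<le> r"
      then have "0 < r" "r < N" "(T ^^ r) y \<in> Q" using r(1) by (auto simp: ret_def)
      then show False using F_sep[OF y, of r] F_stay[OF y, of r] by (auto simp: Q_def)
    qed
    ultimately show ?thesis using r(2) r0(2) by (intro exI[of _ r]) simp
  qed

  define \<C> where "\<C> = (\<lambda>(A, r). (A \<inter> G r, r)) ` (\<P> \<times> {N..2 * N + 1})"
  have \<C>E: "\<exists>A\<in>\<P>. B = A \<inter> G l \<and> N \<le> l \<and> l \<le> 2 * N + 1" if "(B, l) \<in> \<C>" for B l
    using that by (auto simp: \<C>_def)
  show ?thesis
  proof (rule that[of \<C>])
    show "finite \<C>" using \<P>(1) by (simp add: \<C>_def)
    show "clopen B \<and> N \<le> l" if "(B, l) \<in> \<C>" for B l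
      using \<C>E[OF that] \<P>(4) G_clopen clopen_Int by blast
    show "dist ((T ^^ i) a) ((T ^^ i) b) < e" if "(B, l) \<in> \<C>" "i < l" "a \<in> B" "b \<in> B" for B l i a b
    proof -
      obtain A where "A \<in> \<P>" "B = A \<inter> G l" "l \<le> 2 * N + 1" using \<C>E \<open>(B, l) \<in> \<C>\<close> by blast
      then show ?thesis using mesh[of A a b i] that(2-4) by simp
    qed
    show "castle X T \<C>"
      unfolding castle_def
    proof (intro conjI ballI)
      fix c assume "c \<in> \<C>"
      then obtain B l where c: "c = (B, l)" "(B, l) \<in> \<C>" by (cases c) auto
      then obtain A where A: "A \<in> \<P>" "B = A \<inter> G l" "N \<le> l" using \<C>E by blast
      have "B \<inter> preim X T i B = {}" if "i \<in> {1..l - 1}" for i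
      proof -
        have i: "0 < i" "i < l" using that by auto
        have "(T ^^ i) b \<notin> G l" if "b \<in> G l" for b
          using that i G[of b l] G[of "(T ^^ i) b" l] by (auto simp: Q_def)
        then show ?thesis using A(2) by (auto simp: mem_preim)
      qed
      then have "is_tower X T B l" unfolding is_tower_def using A GX N by auto
      then show "case c of (B, l) \<Rightarrow> is_tower X T B l" using c by simp
    next
      have "(B, l) = (B', l')" if BC: "(B, l) \<in> \<C>" "(B', l') \<in> \<C>"
        and y: "y \<in> tower T B l" "y \<in> tower T B' l'" for B l B' l' y
      proof -
        obtain A where A: "A \<in> \<P>" "B = A \<inter> G l" using \<C>E[OF BC(1)] by blast
        obtain A' where A': "A' \<in> \<P>" "B' = A' \<inter> G l'" using \<C>E[OF BC(2)] by blast
        obtain b i where b: "b \<in> B" "i < l" "y = (T ^^ i) b" using y(1) by (rule tower_memE)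
        obtain b' i' where b': "b' \<in> B'" "i' < l'" "y = (T ^^ i') b'" using y(2) by (rule tower_memE)
        have eq: "l = l' \<and> b = b'" using G_unique[of b l b' l' i i'] b b' A(2) A'(2) by auto
        then have "b \<in> A" "b \<in> A'" using b(1) b'(1) A(2) A'(2) by auto
        then have "A = A'" using disjointD[OF \<P>(3) A(1) A'(1)] by blast
        then show ?thesis using eq A(2) A'(2) by simp
      qed
      then show "disjoint_family_on (\<lambda>(B, l). tower T B l) \<C>"
        unfolding disjoint_family_on_def by (force simp: disjoint_iff)
    qed
    show "(\<Union>(B, l)\<in>\<C>. tower T B l) = Y"
    proof (intro equalityI subsetI)
      fix y assume "y \<in> (\<Union>(B, l)\<in>\<C>. tower T B l)"
      then obtain B l where B: "(B, l) \<in> \<C>" "y \<in> tower T B l" by auto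
      obtain b i where "b \<in> B" "i < l" "y = (T ^^ i) b" using B(2) by (rule tower_memE)
      then show "y \<in> Y" using \<C>E[OF B(1)] G_floor by blast
    next
      fix y assume y: "y \<in> Y"
      (* n is the time since the most recent marker in the current stay of y in Y *)
      define reaches where "reaches n \<longleftrightarrow> (\<exists>f\<in>F. (T ^^ n) f = y \<and> (\<forall>m\<le>n. (T ^^ m) f \<in> Y))" for n
      define n where "n = (LEAST n. reaches n)"
      have "reaches n" unfolding n_def by (rule LeastI_ex) (use past[OF y] in \<open>auto simp: reaches_def\<close>)
      then obtain f where f: "f \<in> F" "(T ^^ n) f = y" "\<And>m. m \<le> n \<Longrightarrow> (T ^^ m) f \<in> Y"
        by (auto simp: reaches_def)
      obtain r where r: "N \<le> r" "r \<le> 2 * N + 1" "f \<in> G r" using return[OF f(1)] by blast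
      have "n < r"
      proof (rule ccontr)
        assume "\<not> n < r"
        then have rn: "r \<le> n" by simp
        have "(T ^^ r) f \<in> F" using r(3) f(3)[OF rn] by (simp add: G Q_def)
        then have "reaches (n - r)"
          unfolding reaches_def using f(2,3) rn
          by (intro bexI[of _ "(T ^^ r) f"]) (auto simp: funpow_plus)
        then have "n \<le> n - r" unfolding n_def by (rule Least_le)
        then show False using rn r(1) N by simp
      qed
      obtain A where A: "A \<in> \<P>" "f \<in> A" using f(1) FY YX \<P>(2) by blast
      then have "(A \<inter> G r, r) \<in> \<C>" using r unfolding \<C>_def by force
      moreover have "y \<in> tower T (A \<inter> G r) r"
        using A(2) r(3) \<open>n < r\<close> f(2) by (auto intro: tower_memI)
      ultimately show "y \<in> (\<Union>(B, l)\<in>\<C>. tower T B l)" by blast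
    qed
  qed
qed

end

section \<open>Joining the two castles\<close>

lemma castle_partition_Un:
  assumes "castle X T \<C>\<^sub>1" "castle X T \<C>\<^sub>2"
    and "(\<Union>(B, l)\<in>\<C>\<^sub>2. tower T B l) = X - (\<Union>(B, l)\<in>\<C>\<^sub>1. tower T B l)"
    and "(\<Union>(B, l)\<in>\<C>\<^sub>1. tower T B l) \<subseteq> X"
  shows "castle_partition X T (\<C>\<^sub>1 \<union> \<C>\<^sub>2)"
proof -
  have "disjoint_family_on (\<lambda>(B, l). tower T B l) (\<C>\<^sub>1 \<union> \<C>\<^sub>2)"
    unfolding disjoint_family_on_def
  proof (intro ballI impI)
    fix c c' assume c: "c \<in> \<C>\<^sub>1 \<union> \<C>\<^sub>2" "c' \<in> \<C>\<^sub>1 \<union> \<C>\<^sub>2" "c \<noteq> c'"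
    have across: "(case c of (B, l) \<Rightarrow> tower T B l) \<inter> (case c' of (B, l) \<Rightarrow> tower T B l) = {}"
      if "c \<in> \<C>\<^sub>1" "c' \<in> \<C>\<^sub>2" for c c'
      using assms(3) that by (auto simp: set_eq_iff split: prod.splits)
    have within: "(case c of (B, l) \<Rightarrow> tower T B l) \<inter> (case c' of (B, l) \<Rightarrow> tower T B l) = {}"
      if "\<C> \<in> {\<C>\<^sub>1, \<C>\<^sub>2}" "c \<in> \<C>" "c' \<in> \<C>" for \<C>
    proof -
      have "castle X T \<C>" using assms(1,2) that(1) by auto
      then have "disjoint_family_on (\<lambda>(B, l). tower T B l) \<C>" by (simp add: castle_def)
      then show ?thesis by (rule disjoint_family_onD[OF _ that(2,3) c(3)])
    qed
    show "(case c of (B, l) \<Rightarrow> tower T B l) \<inter> (case c' of (B, l) \<Rightarrow> tower T B l) = {}"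
      using c(1,2) within[of \<C>\<^sub>1] within[of \<C>\<^sub>2] across[of c c'] across[of c' c]
      by (simp add: Int_commute) metis
  qed
  then show ?thesis
    using assms unfolding castle_partition_def castle_def by auto
qed

theorem theorem4p1:
  fixes X :: "'a::metric_space set" and T S :: "'a \<Rightarrow> 'a" and N :: nat and \<delta> :: real
  assumes "compact X"
    and "zero_dimensional (top_of_set X)"
    and "homeomorphism X X T S"
    and "N > 0"
    and "finite {x \<in> X. \<exists>p<N. has_period T x p}"
    and "\<delta> > 0"
  shows "\<exists>\<C>. finite \<C> \<and> castle_partition X T \<C> \<and>
           (\<forall>(B, l)\<in>\<C>. capturing X T N (tower T B l) \<and>
              (\<forall>F\<in>floors T B l. openin (top_of_set X) F \<and> closedin (top_of_set X) F \<and>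
                 diameter F < \<delta>))"
proof -
  interpret zero_dimensional_system X T S by standard (use assms in auto)
  have fin: "finite (short_periodic X T N)" using assms(5) by (simp add: short_periodic_def)
  have pos: "0 < \<delta> / 2" using assms(6) by simp
  obtain \<C>\<^sub>1 where C1: "finite \<C>\<^sub>1" "castle X T \<C>\<^sub>1"
    and C1_cap: "\<And>B l. (B, l) \<in> \<C>\<^sub>1 \<Longrightarrow> clopen B \<and> capturing X T N (tower T B l)"
    and C1_small: "\<And>B l i a b. (B, l) \<in> \<C>\<^sub>1 \<Longrightarrow> i < l \<Longrightarrow> a \<in> B \<Longrightarrow> b \<in> B \<Longrightarrow>
       dist ((T ^^ i) a) ((T ^^ i) b) < \<delta> / 2"
    and C1_compl: "capturing X T N (X - (\<Union>(B, l)\<in>\<C>\<^sub>1. tower T B l))"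
    and C1_per: "short_periodic X T N \<subseteq> (\<Union>(B, l)\<in>\<C>\<^sub>1. tower T B l)"
    by (rule small_castle_at_short_periods[OF assms(4) pos fin]) (rule that; assumption)
  define K where "K = (\<Union>(B, l)\<in>\<C>\<^sub>1. tower T B l)"
  have "clopen (tower T B l)" if "(B, l) \<in> \<C>\<^sub>1" for B l
    unfolding tower_def using C1_cap that by (intro clopen_UN clopen_image) auto
  then have K: "clopen K" unfolding K_def using C1(1) by (intro clopen_UN) auto
  have Y: "clopen (X - K)" by (intro clopen_Diff clopen_space K)
  have Y_aper: "(X - K) \<inter> short_periodic X T N = {}" using C1_per by (auto simp: K_def)
  obtain \<C>\<^sub>2 where C2: "finite \<C>\<^sub>2" "castle X T \<C>\<^sub>2"
    and C2_high: "\<And>B l. (B, l) \<in> \<C>\<^sub>2 \<Longrightarrow> clopen B \<and> N \<le> l"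
    and C2_small: "\<And>B l i a b. (B, l) \<in> \<C>\<^sub>2 \<Longrightarrow> i < l \<Longrightarrow> a \<in> B \<Longrightarrow> b \<in> B \<Longrightarrow>
       dist ((T ^^ i) a) ((T ^^ i) b) < \<delta> / 2"
    and C2_un: "(\<Union>(B, l)\<in>\<C>\<^sub>2. tower T B l) = X - K"
    by (rule high_castle_without_short_periods[OF assms(4) pos Y C1_compl[folded K_def] Y_aper]) (rule that; assumption)
  have "castle_partition X T (\<C>\<^sub>1 \<union> \<C>\<^sub>2)"
    using castle_partition_Un[OF C1(2) C2(2)] C2_un clopen_subset[OF K] by (simp add: K_def)
  moreover have "capturing X T N (tower T B l) \<and>
      (\<forall>F\<in>floors T B l. openin (top_of_set X) F \<and> closedin (top_of_set X) F \<and> diameter F < \<delta>)"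
    if BC: "(B, l) \<in> \<C>\<^sub>1 \<union> \<C>\<^sub>2" for B l
  proof -
    have B: "clopen B" "capturing X T N (tower T B l)"
      using BC C1_cap C2_high capturing_tower_high[OF clopen_subset] by blast+
    have "clopen F \<and> diameter F < \<delta>" if F: "F \<in> floors T B l" for F
    proof -
      obtain i where i: "i < l" "F = (T ^^ i) ` B" using F by (auto simp: floors_def)
      have "diameter F < \<delta>"
        by (rule diameter_less[OF assms(6)]) (use BC C1_small C2_small i in blast)
      then show ?thesis using clopen_image[OF B(1)] i(2) by simp
    qed
    then show ?thesis using B(2) by (auto simp: clopen_def)
  qed
  ultimately show ?thesis using C1(1) C2(1) by (intro exI[of _ "\<C>\<^sub>1 \<union> \<C>\<^sub>2"]) auto
qed

end
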